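(* Let $0<p<1$, let $I$ be a bounded interval, and let $f=(f_n)_{n=1}^{\infty}\colon I\to\ell_p$ be measurable. Then $f\in L_V^1(I,\ell_p)$ if and only if $$\sum_{n=1}^{\infty}\|f_n\|_{L_1(I)}^p<\infty.$$ Further, $\|f\|_{1,V}=\left(\sum_{n=1}^{\infty}\|f_n\|_{L_1(I)}^p\right)^{1/p}$.
   Context: Here $I\subset\mathbb{R}$ carries Lebesgue measure, and $\ell_p$ is the space of real sequences $x=(x_n)_{n=1}^\infty$ with $\|x\|_p=(\sum_n|x_n|^p)^{1/p}<\infty$. A function $f\colon I\to\ell_p$ is integrable in the sense of Vogt, written $f\in L^1_V(I,\ell_p)$, if there are sequences $(x_j)_{j=1}^\infty$ in $\ell_p$ and $(g_j)_{j=1}^\infty$ in $L_1(I,\mathbb{R})$ such that $$\sum_{j=1}^\infty\|x_j\|_p^p\,\|g_j\|_{L_1(I)}^p<\infty\quad\text{and}\quad f(t)=\sum_{j=1}^\infty x_j\,g_j(t)\ \text{ for a.e. } t\in I.$$ For $f\in L^1_V(I,\ell_p)$, $\|f\|_{1,V}$ is the infimum of $\left(\sum_{j}\|x_j\|_p^p\|g_j\|_{L_1(I)}^p\right)^{1/p}$ over all such representations. The formula for $\|f\|_{1,V}$ in the claim concerns $f\in L^1_V(I,\ell_p)$. *)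

theory Defs
  imports "HOL-Analysis.Analysis"
begin

text \<open>Real sequences are functions on \<^typ>\<open>nat\<close>, so all indices start at 0 instead of 1.\<close>

definition lp :: "real \<Rightarrow> (nat \<Rightarrow> real) set" where
  "lp p = {x. summable (\<lambda>n. \<bar>x n\<bar> powr p)}"

text \<open>Only meaningful on \<^term>\<open>lp p\<close>: the series is a junk value elsewhere.\<close>

definition lp_norm :: "real \<Rightarrow> (nat \<Rightarrow> real) \<Rightarrow> real" where
  "lp_norm p x = (\<Sum>n. \<bar>x n\<bar> powr p) powr (1 / p)"

definition lp_open :: "real \<Rightarrow> (nat \<Rightarrow> real) set \<Rightarrow> bool" where
  "lp_open p U \<longleftrightarrow> U \<subseteq> lp p \<and>
     (\<forall>x\<in>U. \<exists>e>0. \<forall>y\<in>lp p. lp_norm p (\<lambda>n. y n - x n) < e \<longrightarrow> y \<in> U)"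

text \<open>The Borel sigma-algebra of the quasi-norm topology. As the space is separable,
  measurability with respect to it coincides, for functions on a Lebesgue measurable set, with
  being almost everywhere a limit of simple functions.\<close>

definition lp_borel :: "real \<Rightarrow> (nat \<Rightarrow> real) measure" where
  "lp_borel p = sigma (lp p) {U. lp_open p U}"

definition lp_sums :: "real \<Rightarrow> (nat \<Rightarrow> nat \<Rightarrow> real) \<Rightarrow> (nat \<Rightarrow> real) \<Rightarrow> bool" where
  "lp_sums p s y \<longleftrightarrow> (\<forall>j. s j \<in> lp p) \<and> y \<in> lp p \<and>
     (\<lambda>N. lp_norm p (\<lambda>n. y n - (\<Sum>j<N. s j n))) \<longlonglongrightarrow> 0"

text \<open>A real number, hence only meaningful for integrable \<^term>\<open>g\<close>: the Bochner integral is 0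
  otherwise.\<close>

definition L1_norm :: "real set \<Rightarrow> (real \<Rightarrow> real) \<Rightarrow> real" where
  "L1_norm I g = (LINT t|lebesgue_on I. \<bar>g t\<bar>)"

definition vogt_rep :: "real \<Rightarrow> real set \<Rightarrow> (real \<Rightarrow> nat \<Rightarrow> real) \<Rightarrow>
    (nat \<Rightarrow> nat \<Rightarrow> real) \<Rightarrow> (nat \<Rightarrow> real \<Rightarrow> real) \<Rightarrow> bool" where
  "vogt_rep p I f x g \<longleftrightarrow>
     (\<forall>j. x j \<in> lp p) \<and> (\<forall>j. integrable (lebesgue_on I) (g j)) \<and>
     summable (\<lambda>j. lp_norm p (x j) powr p * L1_norm I (g j) powr p) \<and>
     (AE t in lebesgue_on I. lp_sums p (\<lambda>j n. x j n * g j t) (f t))"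

definition L1V :: "real \<Rightarrow> real set \<Rightarrow> (real \<Rightarrow> nat \<Rightarrow> real) set" where
  "L1V p I = {f. (\<forall>t\<in>I. f t \<in> lp p) \<and> (\<exists>x g. vogt_rep p I f x g)}"

definition L1V_norm :: "real \<Rightarrow> real set \<Rightarrow> (real \<Rightarrow> nat \<Rightarrow> real) \<Rightarrow> real" where
  "L1V_norm p I f =
     Inf {(\<Sum>j. lp_norm p (x j) powr p * L1_norm I (g j) powr p) powr (1 / p) | x g.
          vogt_rep p I f x g}"

end

theory Submission
  imports Defs
begin

text \<open>Coordinatewise, a representation \<open>f = (\<Sum>j. x j * g j)\<close> gives
  \<open>\<parallel>f n\<parallel> \<le> (\<Sum>j. \<bar>x j n\<bar> * \<parallel>g j\<parallel>)\<close> by the triangle inequality in \<open>L1\<close>. As \<open>u powr p\<close> is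
  subadditive for \<open>p < 1\<close>, taking \<open>p\<close>-th powers and summing over \<open>n\<close> yields
  \<open>(\<Sum>n. \<parallel>f n\<parallel> powr p) \<le> (\<Sum>j. \<parallel>x j\<parallel> powr p * \<parallel>g j\<parallel> powr p)\<close>. The expansion of \<open>f\<close> along the unit
  vectors attains equality.\<close>

section \<open>Subadditivity of \<open>u powr p\<close>, for finite sums and for series\<close>

text \<open>Dividing by \<open>a + b\<close> turns the summands into two numbers in [0, 1] with sum
  1. On [0, 1] an exponent at most 1 can only increase a number, so the powers of the two quotients
  add up to at least 1.\<close>

lemma powr_add_le:
  fixes a b p :: real
  assumes "0 \<le> a" "0 \<le> b" "0 < p" "p \<le> 1"
  shows "(a + b) powr p \<le> a powr p + b powr p"
proof (cases "a + b = 0")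
  case True
  then show ?thesis using assms by simp
next
  case False
  then have s: "a + b > 0" using assms by linarith
  have *: "c / (a + b) \<le> (c / (a + b)) powr p" if "0 \<le> c" "c \<le> a + b" for c
  proof (cases "c = 0")
    case False
    then have "(c / (a + b)) powr 1 \<le> (c / (a + b)) powr p"
      using that s assms by (intro powr_mono') auto
    then show ?thesis using that s by simp
  qed simp
  have "1 = a / (a + b) + b / (a + b)"
    using s by (simp flip: add_divide_distrib)
  also have "\<dots> \<le> (a / (a + b)) powr p + (b / (a + b)) powr p"
    using assms by (intro add_mono *) auto
  also have "\<dots> = (a powr p + b powr p) / (a + b) powr p"
    using assms s by (simp add: powr_divide add_divide_distrib)
  finally show ?thesis using s by (simp add: field_simps)
qed

lemma powr_sum_le:
  fixes a :: "'i \<Rightarrow> real"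
  assumes "finite A" "\<And>i. i \<in> A \<Longrightarrow> 0 \<le> a i" "0 < p" "p \<le> 1"
  shows "(\<Sum>i\<in>A. a i) powr p \<le> (\<Sum>i\<in>A. a i powr p)"
  using assms(1,2)
proof (induction A)
  case (insert i A)
  have "(a i + sum a A) powr p \<le> a i powr p + sum a A powr p"
    using insert.prems assms by (intro powr_add_le sum_nonneg) auto
  also have "\<dots> \<le> a i powr p + (\<Sum>i\<in>A. a i powr p)"
    using insert by simp
  finally show ?case using insert.hyps by simp
qed simp

text \<open>Finite subadditivity bounds every partial sum of \<open>a\<close> by the same number,
  the \<open>1 / p\<close> power of the series of powers. This uniform bound gives the convergence
  of \<open>a\<close> and survives the passage to the limit.\<close>

lemma powr_suminf_le:
  fixes a :: "nat \<Rightarrow> real"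
  assumes nn: "\<And>i. 0 \<le> a i" and p: "0 < p" "p \<le> 1" and sm: "summable (\<lambda>i. a i powr p)"
  shows "summable a" and "(\<Sum>i. a i) powr p \<le> (\<Sum>i. a i powr p)"
proof -
  let ?S = "\<Sum>i. a i powr p"
  have S: "0 \<le> ?S" by (intro suminf_nonneg sm) simp
  have part: "sum a {..<n} powr p \<le> ?S" for n
  proof -
    have "sum a {..<n} powr p \<le> (\<Sum>i<n. a i powr p)"
      using nn p by (intro powr_sum_le) auto
    also have "\<dots> \<le> ?S" by (intro sum_le_suminf sm) auto
    finally show ?thesis .
  qed
  have root: "sum a {..<n} \<le> ?S powr (1 / p)" for n
  proof -
    have "(sum a {..<n} powr p) powr (1 / p) \<le> ?S powr (1 / p)"
      using part p by (intro powr_mono2) auto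
    then show ?thesis using p nn by (simp add: powr_powr sum_nonneg)
  qed
  show s: "summable a"
    using nn root by (intro summableI_nonneg_bounded) auto
  have "(\<Sum>i. a i) \<le> ?S powr (1 / p)"
    using root s by (intro suminf_le_const) auto
  then have "(\<Sum>i. a i) powr p \<le> (?S powr (1 / p)) powr p"
    using nn s p by (intro powr_mono2 suminf_nonneg) auto
  then show "(\<Sum>i. a i) powr p \<le> ?S" using p S by (simp add: powr_powr)
qed

section \<open>The quasi-norm and linear structure of \<open>lp p\<close>\<close>

lemma lp_norm_powr:
  assumes "0 < p" "x \<in> lp p"
  shows "lp_norm p x powr p = (\<Sum>n. \<bar>x n\<bar> powr p)"
proof -
  have "0 \<le> (\<Sum>n. \<bar>x n\<bar> powr p)"
    using assms by (intro suminf_nonneg) (auto simp: lp_def)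
  then show ?thesis using assms by (simp add: lp_norm_def powr_powr)
qed

text \<open>One term of a nonnegative series is at most its sum. Coordinates are therefore
  continuous for the quasi-norm, which serves both convergence and measurability below.\<close>

lemma abs_le_lp_norm:
  assumes "0 < p" "x \<in> lp p"
  shows "\<bar>x n\<bar> \<le> lp_norm p x"
proof -
  have "(\<Sum>k\<in>{n}. \<bar>x k\<bar> powr p) \<le> (\<Sum>k. \<bar>x k\<bar> powr p)"
    using assms(2) by (intro sum_le_suminf) (auto simp: lp_def)
  then have "(\<bar>x n\<bar> powr p) powr (1 / p) \<le> (\<Sum>k. \<bar>x k\<bar> powr p) powr (1 / p)"
    using assms(1) by (intro powr_mono2) auto
  then show ?thesis using assms(1) by (simp add: lp_norm_def powr_powr)
qed

text \<open>Closure under linear operations lets \<open>abs_le_lp_norm\<close> be applied to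
  remainders of series and to differences of points.\<close>

lemma lp_add:
  assumes p: "0 < p" "p \<le> 1" and "x \<in> lp p" "y \<in> lp p"
  shows "(\<lambda>n. x n + y n) \<in> lp p"
proof -
  have le: "\<bar>x n + y n\<bar> powr p \<le> \<bar>x n\<bar> powr p + \<bar>y n\<bar> powr p" for n
  proof -
    have "\<bar>x n + y n\<bar> powr p \<le> (\<bar>x n\<bar> + \<bar>y n\<bar>) powr p"
      using p by (intro powr_mono2) auto
    also have "\<dots> \<le> \<bar>x n\<bar> powr p + \<bar>y n\<bar> powr p"
      using p by (intro powr_add_le) auto
    finally show ?thesis .
  qed
  have "summable (\<lambda>n. \<bar>x n\<bar> powr p + \<bar>y n\<bar> powr p)"
    using assms by (intro summable_add) (auto simp: lp_def)
  then show ?thesis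
    unfolding lp_def using le by (auto intro: summable_comparison_test')
qed

lemma lp_diff:
  assumes "0 < p" "p \<le> 1" "x \<in> lp p" "y \<in> lp p"
  shows "(\<lambda>n. x n - y n) \<in> lp p"
proof -
  have "(\<lambda>n. - y n) \<in> lp p" using assms(4) by (simp add: lp_def)
  from lp_add[OF assms(1-3) this] show ?thesis by simp
qed

lemma lp_sum:
  assumes "0 < p" "p \<le> 1" "\<And>j. s j \<in> lp p"
  shows "(\<lambda>n. \<Sum>j<(N::nat). s j n) \<in> lp p"
proof (induction N)
  case 0
  show ?case using assms(1) by (simp add: lp_def)
next
  case (Suc N)
  from lp_add[OF assms(1,2) Suc assms(3)] show ?case by simp
qed

text \<open>Each coordinate of the remainder is dominated by its quasi-norm, which tends to 0. This
  reduces a vector-valued representation to scalar series.\<close>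

lemma lp_sums_coordinate:
  assumes p: "0 < p" "p \<le> 1" and s: "lp_sums p s y"
  shows "(\<lambda>j. s j n) sums y n"
proof -
  have lim: "(\<lambda>N. lp_norm p (\<lambda>n. y n - (\<Sum>j<N. s j n))) \<longlonglongrightarrow> 0"
    using s by (simp add: lp_sums_def)
  have "\<bar>y n - (\<Sum>j<N. s j n)\<bar> \<le> lp_norm p (\<lambda>n. y n - (\<Sum>j<N. s j n))" for N
    using s p by (intro abs_le_lp_norm lp_diff lp_sum) (auto simp: lp_sums_def)
  then have "(\<lambda>N. y n - (\<Sum>j<N. s j n)) \<longlonglongrightarrow> 0"
    by (intro Lim_null_comparison[OF _ lim]) auto
  from tendsto_diff[OF tendsto_const[of "y n"] this] show ?thesis
    by (simp add: sums_def)
qed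

section \<open>Borel measurability of the coordinates\<close>

lemma space_lp_borel: "space (lp_borel p) = lp p"
  unfolding lp_borel_def by (rule space_measure_of) (auto simp: lp_open_def)

lemma measurable_lp_coordinate:
  assumes "0 < p" "p \<le> 1"
  shows "(\<lambda>y. y n) \<in> borel_measurable (lp_borel p)"
proof (rule borel_measurableI)
  fix S :: "real set"
  assume "open S"
  have "lp_open p ((\<lambda>y. y n) -` S \<inter> lp p)"
    unfolding lp_open_def
  proof (intro conjI ballI)
    fix x assume x: "x \<in> (\<lambda>y. y n) -` S \<inter> lp p"
    \<comment> \<open>The radius \<open>e\<close> found on the real line serves unchanged in
      \<open>lp p\<close>, because passing to a coordinate does not increase distances.\<close>
    then obtain e where e: "e > 0" "\<And>r. dist r (x n) < e \<Longrightarrow> r \<in> S"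
      using \<open>open S\<close> by (auto simp: open_dist)
    have "y \<in> (\<lambda>y. y n) -` S \<inter> lp p"
      if "y \<in> lp p" "lp_norm p (\<lambda>n. y n - x n) < e" for y
    proof -
      have "\<bar>y n - x n\<bar> \<le> lp_norm p (\<lambda>n. y n - x n)"
        using assms x that by (intro abs_le_lp_norm lp_diff) auto
      then show ?thesis using that e by (auto simp: dist_real_def)
    qed
    then show "\<exists>e>0. \<forall>y\<in>lp p. lp_norm p (\<lambda>n. y n - x n) < e \<longrightarrow> y \<in> (\<lambda>y. y n) -` S \<inter> lp p"
      using e(1) by blast
  qed auto
  then have "(\<lambda>y. y n) -` S \<inter> lp p \<in> sigma_sets (lp p) {U. lp_open p U}"
    by auto
  moreover have "{U. lp_open p U} \<subseteq> Pow (lp p)" by (auto simp: lp_open_def)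
  ultimately show "(\<lambda>y. y n) -` S \<inter> space (lp_borel p) \<in> sets (lp_borel p)"
    unfolding space_lp_borel by (simp add: lp_borel_def)
qed

section \<open>The triangle inequality in L1 for series\<close>

text \<open>The estimate is made with the extended nonnegative integral, where sum and integral may
  be exchanged without knowing that \<open>F\<close> is integrable. Finiteness of the bound then
  yields integrability.\<close>

lemma integrable_AE_sums:
  fixes h :: "nat \<Rightarrow> 'a \<Rightarrow> real"
  assumes int: "\<And>j. integrable M (h j)" and F: "F \<in> borel_measurable M"
    and sums: "AE t in M. (\<lambda>j. h j t) sums F t"
    and sm: "summable (\<lambda>j. LINT t|M. \<bar>h j t\<bar>)"
  shows "integrable M F" and "(LINT t|M. \<bar>F t\<bar>) \<le> (\<Sum>j. LINT t|M. \<bar>h j t\<bar>)"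
proof -
  have [measurable]: "h j \<in> borel_measurable M" for j
    using int by auto
  \<comment> \<open>In \<open>ennreal\<close> this holds even at points where the series of absolute
    values diverges.\<close>
  have ptw: "ennreal \<bar>F t\<bar> \<le> (\<Sum>j. ennreal \<bar>h j t\<bar>)" if "(\<lambda>j. h j t) sums F t" for t
  proof (rule LIMSEQ_le_const2)
    show "(\<lambda>N. ennreal \<bar>\<Sum>j<N. h j t\<bar>) \<longlonglongrightarrow> ennreal \<bar>F t\<bar>"
      using that by (intro tendsto_ennrealI tendsto_rabs) (simp add: sums_def)
    have "ennreal \<bar>\<Sum>j<N. h j t\<bar> \<le> (\<Sum>j. ennreal \<bar>h j t\<bar>)" for N
    proof -
      have "ennreal \<bar>\<Sum>j<N. h j t\<bar> \<le> (\<Sum>j<N. ennreal \<bar>h j t\<bar>)"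
        by (simp add: sum_ennreal ennreal_leI sum_abs)
      also have "\<dots> \<le> (\<Sum>j. ennreal \<bar>h j t\<bar>)"
        by (intro sum_le_suminf) auto
      finally show ?thesis .
    qed
    then show "\<exists>N. \<forall>n\<ge>N. ennreal \<bar>\<Sum>j<n. h j t\<bar> \<le> (\<Sum>j. ennreal \<bar>h j t\<bar>)" by blast
  qed
  have "(\<integral>\<^sup>+t. ennreal \<bar>F t\<bar> \<partial>M) \<le> (\<integral>\<^sup>+t. (\<Sum>j. ennreal \<bar>h j t\<bar>) \<partial>M)"
    using sums by (intro nn_integral_mono_AE) (auto elim!: eventually_mono intro: ptw)
  also have "\<dots> = (\<Sum>j. \<integral>\<^sup>+t. ennreal \<bar>h j t\<bar> \<partial>M)"
    by (intro nn_integral_suminf) simp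
  also have "\<dots> = (\<Sum>j. ennreal (LINT t|M. \<bar>h j t\<bar>))"
    using int by (intro suminf_cong nn_integral_eq_integral) auto
  also have "\<dots> = ennreal (\<Sum>j. LINT t|M. \<bar>h j t\<bar>)"
    using sm by (intro suminf_ennreal2) auto
  finally have le: "(\<integral>\<^sup>+t. ennreal \<bar>F t\<bar> \<partial>M) \<le> ennreal (\<Sum>j. LINT t|M. \<bar>h j t\<bar>)" .
  then show iF: "integrable M F"
    using F by (intro integrableI_bounded) (auto simp: order_le_less_trans)
  have "(\<integral>\<^sup>+t. ennreal \<bar>F t\<bar> \<partial>M) = ennreal (LINT t|M. \<bar>F t\<bar>)"
    using iF by (intro nn_integral_eq_integral) auto
  with le show "(LINT t|M. \<bar>F t\<bar>) \<le> (\<Sum>j. LINT t|M. \<bar>h j t\<bar>)"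
    using sm by (simp add: suminf_nonneg)
qed

lemma L1_norm_nonneg: "0 \<le> L1_norm I g"
  by (simp add: L1_norm_def)

section \<open>Lower bound for an arbitrary representation\<close>

text \<open>The array \<open>a j n\<close> is estimated twice: summing over \<open>j\<close>
  controls the coordinate \<open>n\<close> of \<open>f\<close>, while summing \<open>p\<close>-th
  powers over \<open>n\<close> stays below \<open>b j\<close>. The result gives one implication of
  the criterion and bounds the infimum from below.\<close>

lemma vogt_rep_lower_bound:
  assumes p: "0 < p" "p \<le> 1"
    and meas: "\<And>n. (\<lambda>t. f t n) \<in> borel_measurable (lebesgue_on I)"
    and rep: "vogt_rep p I f x g"
  shows "\<And>n. integrable (lebesgue_on I) (\<lambda>t. f t n)"
    and "summable (\<lambda>n. L1_norm I (\<lambda>t. f t n) powr p)"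
    and "(\<Sum>n. L1_norm I (\<lambda>t. f t n) powr p) \<le>
      (\<Sum>j. lp_norm p (x j) powr p * L1_norm I (g j) powr p)"
proof -
  define b where "b j = lp_norm p (x j) powr p * L1_norm I (g j) powr p" for j
  define a where "a j n = \<bar>x j n\<bar> * L1_norm I (g j)" for j n
  have x: "x j \<in> lp p" and g: "integrable (lebesgue_on I) (g j)" for j
    using rep by (auto simp: vogt_rep_def)
  have b: "summable b"
    using rep by (simp add: vogt_rep_def b_def[abs_def])
  have ae: "AE t in lebesgue_on I. lp_sums p (\<lambda>j n. x j n * g j t) (f t)"
    using rep by (simp add: vogt_rep_def)
  have a0: "0 \<le> a j n" for j n
    by (simp add: a_def L1_norm_nonneg)
  have apow: "a j n powr p = \<bar>x j n\<bar> powr p * L1_norm I (g j) powr p" for j n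
    by (simp add: a_def powr_mult L1_norm_nonneg)
  have asum: "(\<Sum>n<N. a j n powr p) \<le> b j" for j N
  proof -
    have "(\<Sum>n<N. \<bar>x j n\<bar> powr p) \<le> lp_norm p (x j) powr p"
      unfolding lp_norm_powr[OF p(1) x]
      using x[of j] by (intro sum_le_suminf) (auto simp: lp_def)
    then show ?thesis
      unfolding apow b_def by (simp flip: sum_distrib_right add: mult_right_mono)
  qed
  have ab: "a j n powr p \<le> b j" for j n
  proof -
    \<comment> \<open>The range ends at \<open>Suc n\<close> so that the term with index
      \<open>n\<close> is included.\<close>
    have "a j n powr p \<le> (\<Sum>k<Suc n. a j k powr p)" by (simp add: sum_nonneg)
    also have "\<dots> \<le> b j" by (rule asum)
    finally show ?thesis .
  qed
  have sa: "summable (\<lambda>j. a j n powr p)" for n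
    using b ab by (auto intro: summable_comparison_test')
  note a_suminf = powr_suminf_le[OF a0 p sa]
  have h: "(LINT t|lebesgue_on I. \<bar>x j n * g j t\<bar>) = a j n" for j n
    by (simp add: abs_mult a_def L1_norm_def)
  have s: "AE t in lebesgue_on I. (\<lambda>j. x j n * g j t) sums f t n" for n
    using ae lp_sums_coordinate[OF p] by (auto elim!: eventually_mono)
  \<comment> \<open>Summable \<open>p\<close>-th powers have summable bases since
    \<open>p \<le> 1\<close>; this supplies the summability that the L1 estimate asks for.\<close>
  have "summable (\<lambda>j. LINT t|lebesgue_on I. \<bar>x j n * g j t\<bar>)" for n
    unfolding h by (rule a_suminf)
  note f = integrable_AE_sums[OF _ meas s this, OF integrable_mult_right[OF g], unfolded h]
  show "integrable (lebesgue_on I) (\<lambda>t. f t n)" for n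
    by (rule f)
  have fn: "L1_norm I (\<lambda>t. f t n) powr p \<le> (\<Sum>j. a j n powr p)" for n
  proof -
    have "L1_norm I (\<lambda>t. f t n) powr p \<le> (\<Sum>j. a j n) powr p"
      using p f(2)[of n] by (intro powr_mono2) (auto simp: L1_norm_def)
    also have "\<dots> \<le> (\<Sum>j. a j n powr p)" by (rule a_suminf)
    finally show ?thesis .
  qed
  \<comment> \<open>Truncation at \<open>N\<close> leaves only a finite sum to exchange with a
    series, for which \<open>sa\<close> suffices. The bound is uniform in \<open>N\<close>, so it
    yields both summability and the final estimate.\<close>
  have part: "(\<Sum>n<N. L1_norm I (\<lambda>t. f t n) powr p) \<le> suminf b" for N
  proof -
    have "(\<Sum>n<N. L1_norm I (\<lambda>t. f t n) powr p) \<le> (\<Sum>n<N. \<Sum>j. a j n powr p)"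
      by (intro sum_mono fn)
    also have "\<dots> = (\<Sum>j. \<Sum>n<N. a j n powr p)"
      using sa by (intro suminf_sum[symmetric]) auto
    also have "\<dots> \<le> suminf b"
      using sa b asum by (intro suminf_le summable_sum) auto
    finally show ?thesis .
  qed
  show sf: "summable (\<lambda>n. L1_norm I (\<lambda>t. f t n) powr p)"
    using part by (intro summableI_nonneg_bounded) auto
  show "(\<Sum>n. L1_norm I (\<lambda>t. f t n) powr p) \<le>
      (\<Sum>j. lp_norm p (x j) powr p * L1_norm I (g j) powr p)"
    using suminf_le_const[OF sf part] by (simp add: b_def[abs_def])
qed

section \<open>The expansion along unit vectors\<close>

text \<open>The remainder after \<open>N\<close> terms vanishes in the first \<open>N\<close>
  coordinates and agrees with \<open>y\<close> in the others, so its quasi-norm is the root of a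
  tail of a convergent series.\<close>

lemma lp_sums_unit_vectors:
  assumes "0 < p" "y \<in> lp p"
  shows "lp_sums p (\<lambda>j n. of_bool (n = j) * y j) y"
proof -
  have sy: "summable (\<lambda>n. \<bar>y n\<bar> powr p)" using assms(2) by (simp add: lp_def)
  have fin: "summable (\<lambda>n. \<bar>of_bool (n = j) * y j\<bar> powr p)" for j
    using assms(1) by (intro summable_finite[of "{j}"]) auto
  have tail: "(\<Sum>n. \<bar>y n - (\<Sum>j<N. of_bool (n = j) * y j)\<bar> powr p) =
      (\<Sum>n. \<bar>y (n + N)\<bar> powr p)" for N
  proof -
    have eq: "\<bar>y n - (\<Sum>j<N. of_bool (n = j) * y j)\<bar> powr p = (if n < N then 0 else \<bar>y n\<bar> powr p)"
      for n
      using assms(1) by (simp add: of_bool_def if_distrib[of "\<lambda>c. c * _"] sum.delta' cong: if_cong)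
    have "summable (\<lambda>n. if n < N then 0 else \<bar>y n\<bar> powr p)"
      using sy by (rule summable_comparison_test') auto
    from suminf_split_initial_segment[OF this, of N] show ?thesis
      unfolding eq by simp
  qed
  have "(\<lambda>N. \<Sum>n. \<bar>y (n + N)\<bar> powr p) \<longlonglongrightarrow> 0"
    using suminf_exist_split2[OF sy] by simp
  \<comment> \<open>The bases tend to 0; continuity of \<open>powr\<close> there rests on their
    nonnegativity and on \<open>1 / p\<close> being positive.\<close>
  then have "(\<lambda>N. (\<Sum>n. \<bar>y (n + N)\<bar> powr p) powr (1 / p)) \<longlonglongrightarrow> 0 powr (1 / p)"
    using assms(1) sy
    by (intro tendsto_powr2) (auto intro!: always_eventually suminf_nonneg summable_ignore_initial_segment[OF sy])
  then show ?thesis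
    unfolding lp_sums_def lp_norm_def tail using fin assms by (simp add: lp_def)
qed

text \<open>Unit vectors have quasi-norm 1, so the cost of this representation is exactly the
  coordinate sum. It proves the converse implication and attains the infimum.\<close>

lemma vogt_rep_unit_vectors:
  assumes p: "0 < p" and f: "\<And>t. t \<in> I \<Longrightarrow> f t \<in> lp p"
    and int: "\<And>n. integrable (lebesgue_on I) (\<lambda>t. f t n)"
    and sm: "summable (\<lambda>n. L1_norm I (\<lambda>t. f t n) powr p)"
  shows "vogt_rep p I f (\<lambda>j n. of_bool (n = j)) (\<lambda>j t. f t j)"
    and "lp_norm p (\<lambda>n. of_bool (n = (j::nat))) powr p = 1"
proof -
  have e: "(\<lambda>n. of_bool (n = j)) \<in> lp p" for j :: nat
    unfolding lp_def using p by (auto intro!: summable_finite[of "{j}"])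
  show norm: "lp_norm p (\<lambda>n. of_bool (n = j)) powr p = 1" for j :: nat
    unfolding lp_norm_powr[OF p e] using p by (subst suminf_finite[of "{j}"]) auto
  show "vogt_rep p I f (\<lambda>j n. of_bool (n = j)) (\<lambda>j t. f t j)"
    unfolding vogt_rep_def norm using e int sm lp_sums_unit_vectors[OF p f]
    by (auto intro!: AE_I2)
qed

theorem proposition4p4:
  fixes p :: real and I :: "real set" and f :: "real \<Rightarrow> nat \<Rightarrow> real"
  assumes "0 < p" and "p < 1"
    and "is_interval I" and "bounded I"
    and "f \<in> measurable (lebesgue_on I) (lp_borel p)"
  shows "(f \<in> L1V p I \<longleftrightarrow>
            (\<forall>n. integrable (lebesgue_on I) (\<lambda>t. f t n)) \<and>
            summable (\<lambda>n. L1_norm I (\<lambda>t. f t n) powr p)) \<and>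
         (f \<in> L1V p I \<longrightarrow>
            L1V_norm p I f = (\<Sum>n. L1_norm I (\<lambda>t. f t n) powr p) powr (1 / p))"
proof -
  have p: "0 < p" "p \<le> 1" using assms by auto
  have f: "f t \<in> lp p" if "t \<in> I" for t
    using measurable_space[OF assms(5)] that by (simp add: space_lp_borel)
  have meas: "(\<lambda>t. f t n) \<in> borel_measurable (lebesgue_on I)" for n
    by (rule measurable_compose[OF assms(5) measurable_lp_coordinate[OF p]])
  note lower = vogt_rep_lower_bound[OF p meas]
  note unit = vogt_rep_unit_vectors[OF p(1) f]
  \<comment> \<open>Finiteness of the L1 norms is stated as integrability, because
    \<open>L1_norm\<close> takes the default value 0 on nonintegrable functions.\<close>
  have iff: "f \<in> L1V p I \<longleftrightarrow> (\<forall>n. integrable (lebesgue_on I) (\<lambda>t. f t n)) \<and>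
      summable (\<lambda>n. L1_norm I (\<lambda>t. f t n) powr p)"
    (is "_ \<longleftrightarrow> ?R")
  proof
    assume "f \<in> L1V p I"
    then obtain x g where "vogt_rep p I f x g" by (auto simp: L1V_def)
    from lower(1,2)[OF this] show ?R by simp
  next
    assume ?R
    then have "vogt_rep p I f (\<lambda>j n. of_bool (n = j)) (\<lambda>j t. f t j)"
      by (intro unit(1)) auto
    with f show "f \<in> L1V p I" by (auto simp: L1V_def)
  qed
  have "L1V_norm p I f = (\<Sum>n. L1_norm I (\<lambda>t. f t n) powr p) powr (1 / p)" if "f \<in> L1V p I"
  proof -
    have int: "\<And>n. integrable (lebesgue_on I) (\<lambda>t. f t n)"
      and sm: "summable (\<lambda>n. L1_norm I (\<lambda>t. f t n) powr p)"
      using that iff by auto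
    show ?thesis
      unfolding L1V_norm_def
    \<comment> \<open>The infimum is a minimum: the unit vector expansion is a member of the set,
      and \<open>lower(3)\<close> followed by the monotone \<open>1 / p\<close> power bounds all
      members from below.\<close>
    proof (rule cInf_eq_minimum)
      show "(\<Sum>n. L1_norm I (\<lambda>t. f t n) powr p) powr (1 / p) \<in>
          {(\<Sum>j. lp_norm p (x j) powr p * L1_norm I (g j) powr p) powr (1 / p) | x g.
            vogt_rep p I f x g}"
        using unit[OF _ int sm]
        by (intro CollectI exI[of _ "\<lambda>j n. of_bool (n = j)"] exI[of _ "\<lambda>j t. f t j"]) simp
    next
      fix r
      assume "r \<in> {(\<Sum>j. lp_norm p (x j) powr p * L1_norm I (g j) powr p) powr (1 / p) | x g.
            vogt_rep p I f x g}"
      then show "(\<Sum>n. L1_norm I (\<lambda>t. f t n) powr p) powr (1 / p) \<le> r"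
        using p(1) lower(3) by (auto intro!: powr_mono2 suminf_nonneg sm)
    qed
  qed
  with iff show ?thesis by blast
qed

end
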